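(* Let $k$ be a field, let $d\ge 1$, let $\Sigma$ be a rational pointed fan in $\mathbb{R}^d$, and let $\mathcal{M}$ be a monoidal complex supported on $\Sigma$, with $\mathbb{Z}^d$-graded toric face ring $k[\mathcal{M}]$. A ring $A$ is a $\mathbb{Z}^d$-graded algebra retract of $k[\mathcal{M}]$ if and only if there is a restricted subfan $\Gamma$ of $\Sigma$ such that $A\cong k[\mathcal{M}_\Gamma]$ (as $\mathbb{Z}^d$-graded $k$-algebras).
   Context: All rings are Noetherian, commutative with unit, and nonzero. A face of a cone $C\subseteq\mathbb{R}^d$ is a nonempty subset of the form $C\cap H$, where $H$ is a hyperplane such that $C$ lies in one of the two closed half-spaces bounded by $H$; $C$ itself is also counted as a face. A cone is pointed if $\{0\}$ is a face of it. A rational pointed fan $\Sigma$ in $\mathbb{R}^d$ is a finite nonempty collection of (polyhedral) cones such that for all $C,D\in\Sigma$: (1) $C$ is pointed and generated by rational vectors; (2) every face of $C$ belongs to $\Sigma$; (3) $C\cap D$ is either empty or a common face of $C$ and $D$. A subfan of $\Sigma$ is a nonempty subcollection that is itself a fan. A monoidal complex $\mathcal{M}$ supported on $\Sigma$ is a collection of affine monoids (finitely generated submonoids of $\mathbb{Z}^d$) $M_C$, $C\in\Sigma$, such that $M_C\subseteq C\cap\mathbb{Z}^d$, $M_C$ generates the cone $C$, and $M_D=M_C\cap D$ whenever $D\subseteq C$ ($C,D\in\Sigma$). Put $|\mathcal{M}|=\bigcup_{C\in\Sigma}M_C$. The toric face ring $k[\mathcal{M}]$ is the $k$-vector space with basis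 $\{t^a: a\in|\mathcal{M}|\}$ and multiplication $t^a\cdot t^b=t^{a+b}$ if $a,b\in M_C$ for some $C\in\Sigma$, and $t^at^b=0$ otherwise; it is $\mathbb{Z}^d$-graded with $\deg t^a=a$. For a subfan $\Gamma$ of $\Sigma$, $\mathcal{M}_\Gamma=\{M_C: C\in\Gamma\}$ is the induced monoidal complex supported on $\Gamma$, and $|\Gamma|=\bigcup_{D\in\Gamma}D$. The subfan $\Gamma$ is a restricted subfan of $\Sigma$ if for all finitely many elements $x_1,\dots,x_n\in|\Gamma|$ such that $x_1,\dots,x_n\in C$ for some $C\in\Sigma$, there is a cone $D\in\Gamma$ with $x_1,\dots,x_n\in D$. A $\mathbb{Z}^d$-graded algebra retract of a $\mathbb{Z}^d$-graded $k$-algebra $B$ is a $\mathbb{Z}^d$-graded $k$-algebra $A$ together with degree-preserving $k$-algebra homomorphisms $\theta:A\to B$ and $\phi:B\to A$ such that $\phi\circ\theta=\mathrm{id}_A$. *)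

theory Defs
  imports "HOL-Analysis.Analysis" "HOL-Algebra.Ring_Divisibility" "HOL-Algebra.Module"
begin

section \<open>Rational pointed fans\<close>

definition cone_face :: "(real ^ 'd::finite) set \<Rightarrow> (real ^ 'd) set \<Rightarrow> bool" where
  "cone_face F C \<longleftrightarrow>
     F = C \<or>
     F \<noteq> {} \<and> (\<exists>u r. u \<noteq> 0 \<and> C \<subseteq> {x. u \<bullet> x \<le> r} \<and> F = C \<inter> {x. u \<bullet> x = r})"

lemma cone_face_iff_exposed_face_of:
  assumes "convex_cone C"
  shows "cone_face F C \<longleftrightarrow> F \<noteq> {} \<and> F exposed_face_of C"
proof -
  have C: "convex C" "C \<noteq> {}"
    using assms by (auto simp: convex_cone_def)
  have "C exposed_face_of C"
    using C by (simp add: exposed_face_of_refl)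
  moreover have "F exposed_face_of C" if "cone_face F C" "F \<noteq> C"
    using that C exposed_face_of_Int_supporting_hyperplane_le[of C]
    by (fastforce simp: cone_face_def)
  moreover have "cone_face F C" if ne: "F \<noteq> {}" and F: "F exposed_face_of C"
  proof -
    obtain u r where ur: "C \<subseteq> {x. u \<bullet> x \<le> r}" "F = C \<inter> {x. u \<bullet> x = r}"
      using F by (auto simp: exposed_face_of_def)
    show ?thesis
    proof (cases "u = 0")
      case True
      with ur ne have "F = C" by auto
      then show ?thesis by (simp add: cone_face_def)
    next
      case False
      with ur ne show ?thesis unfolding cone_face_def by blast
    qed
  qed
  ultimately show ?thesis
    using C by (metis cone_face_def)
qed

definition pointed_cone :: "(real ^ 'd::finite) set \<Rightarrow> bool" where
  "pointed_cone C \<longleftrightarrow> cone_face {0} C"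

definition rational_cone :: "(real ^ 'd::finite) set \<Rightarrow> bool" where
  "rational_cone C \<longleftrightarrow>
     (\<exists>S. finite S \<and> (\<forall>v\<in>S. \<forall>i. v $ i \<in> \<rat>) \<and> C = convex_cone hull S)"

definition rational_pointed_fan :: "(real ^ 'd::finite) set set \<Rightarrow> bool" where
  "rational_pointed_fan \<Sigma> \<longleftrightarrow>
     finite \<Sigma> \<and> \<Sigma> \<noteq> {} \<and>
     (\<forall>C\<in>\<Sigma>. pointed_cone C \<and> rational_cone C) \<and>
     (\<forall>C\<in>\<Sigma>. \<forall>F. cone_face F C \<longrightarrow> F \<in> \<Sigma>) \<and>
     (\<forall>C\<in>\<Sigma>. \<forall>D\<in>\<Sigma>. C \<inter> D = {} \<or> (cone_face (C \<inter> D) C \<and> cone_face (C \<inter> D) D))"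

definition subfan :: "(real ^ 'd::finite) set set \<Rightarrow> (real ^ 'd) set set \<Rightarrow> bool" where
  "subfan \<Gamma> \<Sigma> \<longleftrightarrow> \<Gamma> \<subseteq> \<Sigma> \<and> rational_pointed_fan \<Gamma>"

definition restricted_subfan :: "(real ^ 'd::finite) set set \<Rightarrow> (real ^ 'd) set set \<Rightarrow> bool" where
  "restricted_subfan \<Gamma> \<Sigma> \<longleftrightarrow>
     subfan \<Gamma> \<Sigma> \<and>
     (\<forall>X. finite X \<and> X \<subseteq> \<Union>\<Gamma> \<and> (\<exists>C\<in>\<Sigma>. X \<subseteq> C) \<longrightarrow> (\<exists>D\<in>\<Gamma>. X \<subseteq> D))"


section \<open>Monoidal complexes\<close>

definition real_vec :: "int ^ 'd::finite \<Rightarrow> real ^ 'd" where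
  "real_vec a = (\<chi> i. real_of_int (a $ i))"

definition add_submonoid :: "(int ^ 'd::finite) set \<Rightarrow> bool" where
  "add_submonoid M \<longleftrightarrow> 0 \<in> M \<and> (\<forall>a\<in>M. \<forall>b\<in>M. a + b \<in> M)"

definition affine_monoid :: "(int ^ 'd::finite) set \<Rightarrow> bool" where
  "affine_monoid M \<longleftrightarrow> (\<exists>S. finite S \<and> M = add_submonoid hull S)"

text \<open>A monoidal complex is a family \<open>M\<close> indexed by cones; only its values on members of the
  fan matter. In particular, the complex induced on a subfan is given by the same \<open>M\<close>.\<close>

definition monoidal_complex ::
    "(real ^ 'd::finite) set set \<Rightarrow> ((real ^ 'd) set \<Rightarrow> (int ^ 'd) set) \<Rightarrow> bool" where
  "monoidal_complex \<Sigma> M \<longleftrightarrow>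
     (\<forall>C\<in>\<Sigma>. affine_monoid (M C) \<and> real_vec ` M C \<subseteq> C \<and> convex_cone hull (real_vec ` M C) = C) \<and>
     (\<forall>C\<in>\<Sigma>. \<forall>D\<in>\<Sigma>. D \<subseteq> C \<longrightarrow> M D = {a \<in> M C. real_vec a \<in> D})"


section \<open>Graded algebras and graded algebra retracts\<close>

definition graded_algebra ::
    "('k, 'r) ring_scheme \<Rightarrow> ('k, 'a, 'm) module_scheme \<Rightarrow> (int ^ 'd::finite \<Rightarrow> 'a set) \<Rightarrow> bool" where
  "graded_algebra K A \<A> \<longleftrightarrow>
     algebra K A \<and>
     (\<forall>a. submodule (\<A> a) K A) \<and>
     (\<forall>a b. \<forall>x\<in>\<A> a. \<forall>y\<in>\<A> b. x \<otimes>\<^bsub>A\<^esub> y \<in> \<A> (a + b)) \<and>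
     (\<forall>x\<in>carrier A. \<exists>!f. (\<forall>a. f a \<in> \<A> a) \<and> finite {a. f a \<noteq> \<zero>\<^bsub>A\<^esub>} \<and>
        x = (\<Oplus>\<^bsub>A\<^esub> a\<in>{a. f a \<noteq> \<zero>\<^bsub>A\<^esub>}. f a))"

definition graded_algebra_hom ::
    "('k, 'r) ring_scheme \<Rightarrow>
     ('k, 'a, 'm) module_scheme \<Rightarrow> (int ^ 'd::finite \<Rightarrow> 'a set) \<Rightarrow>
     ('k, 'b, 'n) module_scheme \<Rightarrow> (int ^ 'd \<Rightarrow> 'b set) \<Rightarrow> ('a \<Rightarrow> 'b) set" where
  "graded_algebra_hom K A \<A> B \<B> =
     {h \<in> ring_hom A B.
        (\<forall>c\<in>carrier K. \<forall>x\<in>carrier A. h (c \<odot>\<^bsub>A\<^esub> x) = c \<odot>\<^bsub>B\<^esub> h x) \<and>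
        (\<forall>a. h ` \<A> a \<subseteq> \<B> a)}"

definition graded_algebra_retract ::
    "('k, 'r) ring_scheme \<Rightarrow>
     ('k, 'a, 'm) module_scheme \<Rightarrow> (int ^ 'd::finite \<Rightarrow> 'a set) \<Rightarrow>
     ('k, 'b, 'n) module_scheme \<Rightarrow> (int ^ 'd \<Rightarrow> 'b set) \<Rightarrow> bool" where
  "graded_algebra_retract K A \<A> B \<B> \<longleftrightarrow>
     (\<exists>\<theta>\<in>graded_algebra_hom K A \<A> B \<B>. \<exists>\<phi>\<in>graded_algebra_hom K B \<B> A \<A>.
        \<forall>x\<in>carrier A. \<phi> (\<theta> x) = x)"

definition graded_algebra_isomorphic ::
    "('k, 'r) ring_scheme \<Rightarrow>
     ('k, 'a, 'm) module_scheme \<Rightarrow> (int ^ 'd::finite \<Rightarrow> 'a set) \<Rightarrow>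
     ('k, 'b, 'n) module_scheme \<Rightarrow> (int ^ 'd \<Rightarrow> 'b set) \<Rightarrow> bool" where
  "graded_algebra_isomorphic K A \<A> B \<B> \<longleftrightarrow>
     (\<exists>h\<in>graded_algebra_hom K A \<A> B \<B>. bij_betw h (carrier A) (carrier B))"


section \<open>Toric face rings\<close>

definition complex_support ::
    "(real ^ 'd::finite) set set \<Rightarrow> ((real ^ 'd) set \<Rightarrow> (int ^ 'd) set) \<Rightarrow> (int ^ 'd) set" where
  "complex_support \<Sigma> M = (\<Union>C\<in>\<Sigma>. M C)"

text \<open>The element \<open>f\<close> of the carrier stands for the finite linear combination of the basis elements
  \<open>t\<^sup>a\<close> with coefficients \<open>f a\<close>. The product is the bilinear extension of the rule for
  basis elements; see \<open>toric_face_ring_mult_monom\<close> below.\<close>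

definition toric_face_ring ::
    "('k, 'r) ring_scheme \<Rightarrow> (real ^ 'd::finite) set set \<Rightarrow> ((real ^ 'd) set \<Rightarrow> (int ^ 'd) set) \<Rightarrow>
     ('k, int ^ 'd \<Rightarrow> 'k) module" where
  "toric_face_ring K \<Sigma> M =
     \<lparr> carrier = {f. (\<forall>a. f a \<in> carrier K) \<and> finite {a. f a \<noteq> \<zero>\<^bsub>K\<^esub>} \<and>
                    {a. f a \<noteq> \<zero>\<^bsub>K\<^esub>} \<subseteq> complex_support \<Sigma> M},
       mult = (\<lambda>f g c. finsum K (\<lambda>(a, b). f a \<otimes>\<^bsub>K\<^esub> g b)
                {(a, b). f a \<noteq> \<zero>\<^bsub>K\<^esub> \<and> g b \<noteq> \<zero>\<^bsub>K\<^esub> \<and> a + b = c \<and> (\<exists>C\<in>\<Sigma>. a \<in> M C \<and> b \<in> M C)}),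
       one = (\<lambda>a. if a = 0 then \<one>\<^bsub>K\<^esub> else \<zero>\<^bsub>K\<^esub>),
       zero = (\<lambda>a. \<zero>\<^bsub>K\<^esub>),
       add = (\<lambda>f g a. f a \<oplus>\<^bsub>K\<^esub> g a),
       smult = (\<lambda>c f a. c \<otimes>\<^bsub>K\<^esub> f a) \<rparr>"

definition toric_grading ::
    "('k, 'r) ring_scheme \<Rightarrow> (real ^ 'd::finite) set set \<Rightarrow> ((real ^ 'd) set \<Rightarrow> (int ^ 'd) set) \<Rightarrow>
     int ^ 'd \<Rightarrow> (int ^ 'd \<Rightarrow> 'k) set" where
  "toric_grading K \<Sigma> M a =
     {f \<in> carrier (toric_face_ring K \<Sigma> M). \<forall>b. b \<noteq> a \<longrightarrow> f b = \<zero>\<^bsub>K\<^esub>}"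

definition toric_monom :: "('k, 'r) ring_scheme \<Rightarrow> int ^ 'd::finite \<Rightarrow> int ^ 'd \<Rightarrow> 'k" where
  "toric_monom K a = (\<lambda>b. if b = a then \<one>\<^bsub>K\<^esub> else \<zero>\<^bsub>K\<^esub>)"

lemma toric_face_ring_mult_monom:
  assumes "field K"
  shows "toric_monom K a \<otimes>\<^bsub>toric_face_ring K \<Sigma> M\<^esub> toric_monom K b =
    (if \<exists>C\<in>\<Sigma>. a \<in> M C \<and> b \<in> M C then toric_monom K (a + b) else \<zero>\<^bsub>toric_face_ring K \<Sigma> M\<^esub>)"
proof
  interpret field K by fact
  fix c
  let ?P = "\<exists>C\<in>\<Sigma>. a \<in> M C \<and> b \<in> M C"
  have supp: "{(x, y). toric_monom K a x \<noteq> \<zero>\<^bsub>K\<^esub> \<and> toric_monom K b y \<noteq> \<zero>\<^bsub>K\<^esub> \<and> x + y = c \<and>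
       (\<exists>C\<in>\<Sigma>. x \<in> M C \<and> y \<in> M C)} = (if ?P \<and> a + b = c then {(a, b)} else {})"
    by (auto simp: toric_monom_def)
  show "(toric_monom K a \<otimes>\<^bsub>toric_face_ring K \<Sigma> M\<^esub> toric_monom K b) c =
    (if ?P then toric_monom K (a + b) else \<zero>\<^bsub>toric_face_ring K \<Sigma> M\<^esub>) c"
    by (simp only: toric_face_ring_def monoid.simps ring.simps supp)
       (auto simp: toric_monom_def finsum_insert)
qed

end

theory Submission
  imports Defs
begin

text \<open>For a retract with maps \<open>\<theta>\<close> and \<open>\<phi>\<close>, the idempotent \<open>\<theta> \<circ> \<phi>\<close> preserves the
  one-dimensional graded pieces of \<open>k[M]\<close>, so it fixes or kills each monomial \<open>t\<^sup>a\<close>. As it is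
  multiplicative, the set \<open>S\<close> of the fixed exponents meets each \<open>M C\<close> in a submonoid \<open>N\<close> such that
  \<open>a + b \<in> N\<close> forces \<open>a, b \<in> N\<close>. Such an \<open>N\<close> is cut out of \<open>M C\<close> by a face of \<open>C\<close>, hence is
  \<open>M F\<close> for a cone \<open>F\<close> of the fan. The cones \<open>C\<close> with \<open>M C \<subseteq> S\<close> therefore form a restricted subfan
  with support \<open>S\<close>, and \<open>\<theta>\<close> identifies the retract with its toric face ring. Conversely, for
  a restricted subfan the inclusion of toric face rings is multiplicative, and killing the monomials
  outside the subfan is a homomorphism that splits it.\<close>

section \<open>Faces of affine monoids\<close>

lemma real_vec_0 [simp]: "real_vec 0 = 0"
  by (simp add: real_vec_def vec_eq_iff)

lemma real_vec_add [simp]: "real_vec (a + b) = real_vec a + real_vec b"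
  by (simp add: real_vec_def vec_eq_iff)

lemma inj_real_vec: "inj real_vec"
  by (rule injI) (simp add: real_vec_def vec_eq_iff)

lemma real_vec_eq_0_iff [simp]: "real_vec a = 0 \<longleftrightarrow> a = 0"
  using inj_real_vec real_vec_0 by (metis injD)

lemma add_submonoid_hull: "add_submonoid (add_submonoid hull G)"
  by (rule hull_in) (auto simp: add_submonoid_def)

lemma add_submonoid_scaled:
  fixes x :: "int ^ 'd::finite"
  assumes "add_submonoid N" "x \<in> N" "0 \<le> k"
  shows "k *s x \<in> N"
proof -
  have "int n *s x \<in> N" for n
    using assms by (induction n)
      (auto simp: add_submonoid_def vector_sadd_rdistrib)
  from this[of "nat k"] show ?thesis using assms by simp
qed

lemma add_submonoid_combination:
  fixes X :: "(int ^ 'd::finite) set"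
  assumes "add_submonoid N" "X \<subseteq> N" "\<forall>g\<in>X. 0 \<le> p g"
  shows "(\<Sum>g\<in>X. p g *s g) \<in> N"
proof (cases "finite X")
  case True
  then show ?thesis using assms(2,3)
  proof (induction X rule: finite_induct)
    case empty
    then show ?case using assms(1) by (simp add: add_submonoid_def)
  next
    case (insert x X)
    then show ?case
      using assms(1) add_submonoid_scaled[OF assms(1), of x "p x"] by (simp add: add_submonoid_def)
  qed
next
  case False
  \<comment> \<open>Over an infinite index set the sum is 0 by convention, and 0 lies in
    \<open>N\<close>.\<close>
  then show ?thesis using assms(1) by (simp add: add_submonoid_def)
qed

text \<open>Simultaneous Dirichlet approximation of the coefficients: once the errors are small enough,
  the integral combination \<open>\<Sum> p g *s g\<close> has all its entries smaller than \<open>1\<close> in absolute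
  value.\<close>

lemma integer_relation_from_real:
  fixes G :: "(int ^ 'd::finite) set" and c :: "int ^ 'd \<Rightarrow> real"
  assumes fin: "finite G" and rel: "(\<Sum>g\<in>G. c g *\<^sub>R real_vec g) = 0"
  obtains p :: "int ^ 'd \<Rightarrow> int" where
    "(\<Sum>g\<in>G. p g *s g) = 0"
    "\<And>g. g \<in> G \<Longrightarrow> 0 \<le> c g \<Longrightarrow> 0 \<le> p g"
    "\<And>g. g \<in> G \<Longrightarrow> 0 < c g \<Longrightarrow> 0 < p g"
proof -
  \<comment> \<open>The first sum controls the accumulated error in every coordinate, the second
    dominates each \<open>1 / c g\<close>, and the final 1 makes any \<open>N\<close> above
    \<open>B\<close> positive.\<close>
  define B where "B = (\<Sum>g\<in>G. \<Sum>i\<in>UNIV. \<bar>real_of_int (g $ i)\<bar>) + (\<Sum>g\<in>G. \<bar>1 / c g\<bar>) + 1"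
  have B1: "B \<ge> 1" unfolding B_def by (simp add: sum_nonneg)
  obtain N :: nat where N: "B < real N" using reals_Archimedean2 by blast
  have N0: "N > 0" using B1 N by (cases N) auto
  \<comment> \<open>The approximation theorem treats families indexed by an initial segment of the
    naturals, hence the enumeration of \<open>G\<close>.\<close>
  obtain h where h: "bij_betw h {..<card G} G"
    using ex_bij_betw_nat_finite[OF fin] by (auto simp: atLeast0LessThan)
  obtain q r where q: "0 < q" and
    r: "\<And>i. i < card G \<Longrightarrow> \<bar>of_int q * c (h i) - of_int (r i)\<bar> < 1 / N"
    using Dirichlet_approx_simult[OF N0, of "card G" "\<lambda>i. c (h i)"] by metis
  define p where "p g = r (inv_into {..<card G} h g)" for g
  have p: "\<bar>of_int q * c g - of_int (p g)\<bar> < 1 / N" if "g \<in> G" for g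
    using r[of "inv_into {..<card G} h g"] h that unfolding p_def
    by (metis bij_betw_def bij_betw_inv_into_right inv_into_into lessThan_iff)
  have "(\<Sum>g\<in>G. p g * g $ i) = 0" for i
  proof -
    have "(\<Sum>g\<in>G. c g * real_of_int (g $ i)) = 0"
      using arg_cong[OF rel, of "\<lambda>v. v $ i"] by (simp add: sum_component real_vec_def)
    \<comment> \<open>Subtracting \<open>q\<close> times the real relation leaves only the
      approximation errors. The left-hand side is an integer, so a bound below 1 makes it
      vanish.\<close>
    then have "real_of_int (\<Sum>g\<in>G. p g * g $ i)
        = - (\<Sum>g\<in>G. (of_int q * c g - of_int (p g)) * real_of_int (g $ i))"
      by (simp add: left_diff_distrib sum_subtractf mult.assoc flip: sum_distrib_left)
    then have "\<bar>real_of_int (\<Sum>g\<in>G. p g * g $ i)\<bar>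
        \<le> (\<Sum>g\<in>G. \<bar>(of_int q * c g - of_int (p g)) * real_of_int (g $ i)\<bar>)"
      by simp
    also have "\<dots> \<le> (\<Sum>g\<in>G. 1 / N * (\<Sum>i\<in>UNIV. \<bar>real_of_int (g $ i)\<bar>))"
      using p unfolding abs_mult
      by (intro sum_mono mult_mono) (auto intro: less_imp_le member_le_sum)
    also have "\<dots> = (\<Sum>g\<in>G. \<Sum>i\<in>UNIV. \<bar>real_of_int (g $ i)\<bar>) / N"
      by (simp add: sum_divide_distrib)
    also have "\<dots> \<le> B / N"
      unfolding B_def by (intro divide_right_mono) (simp_all add: sum_nonneg)
    also have "\<dots> < 1" using N N0 by simp
    finally show ?thesis by linarith
  qed
  then have "(\<Sum>g\<in>G. p g *s g) = 0"
    by (simp add: vec_eq_iff sum_component)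
  moreover have "0 \<le> p g" if "g \<in> G" "0 \<le> c g" for g
  proof -
    have "0 \<le> of_int q * c g" using q that by simp
    moreover have "1 / real N \<le> 1" using N0 by simp
    ultimately have "real_of_int (p g) > -1" using p[OF that(1)] by linarith
    then show ?thesis by linarith
  qed
  moreover have "0 < p g" if "g \<in> G" "0 < c g" for g
  proof -
    \<comment> \<open>Here the second summand of \<open>B\<close> enters: \<open>1 / N\<close> stays
      below \<open>c g\<close>, so the error cannot bring \<open>q * c g\<close> down to 0.\<close>
    have "1 / c g \<le> (\<Sum>g\<in>G. \<bar>1 / c g\<bar>)"
      using fin that member_le_sum[of g G "\<lambda>g. \<bar>1 / c g\<bar>"] by auto
    also have "\<dots> \<le> B" unfolding B_def by (simp add: sum_nonneg)
    finally have "1 / c g < N" using N by simp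
    then have "1 / N < c g" using that N0 by (simp add: field_simps)
    also have "c g \<le> of_int q * c g" using q that by simp
    finally have "real_of_int (p g) > 0" using p[OF that(1)] by linarith
    then show ?thesis by simp
  qed
  ultimately show ?thesis using that by blast
qed

text \<open>The functional comes from strictly separating the convex hull of the generators outside
  \<open>S\<close>, a compact set, from the span of those in \<open>S\<close>. A common point would
  be a real relation between generators; its integral version exhibits a generator outside
  \<open>S\<close> as a summand of an element of \<open>S\<close>, against
  \<open>face\<close>.\<close>

lemma monoid_face_exposed:
  fixes G :: "(int ^ 'd::finite) set"
  defines "M \<equiv> add_submonoid hull G"
  assumes fin: "finite G" and S0: "0 \<in> S"
    and face: "\<And>a b. a \<in> M \<Longrightarrow> b \<in> M \<Longrightarrow> a + b \<in> S \<longleftrightarrow> a \<in> S \<and> b \<in> S"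
  obtains u where "\<And>a. a \<in> M \<Longrightarrow> u \<bullet> real_vec a \<le> 0"
    "\<And>a. a \<in> M \<Longrightarrow> u \<bullet> real_vec a = 0 \<longleftrightarrow> a \<in> S"
proof -
  define T where "T = G - S"
  define L where "L = span (real_vec ` (G \<inter> S))"
  have M: "add_submonoid M" unfolding M_def by (rule add_submonoid_hull)
  have GM: "G \<subseteq> M" unfolding M_def by (rule hull_subset)
  have MS: "add_submonoid (M \<inter> S)"
    using M S0 face by (auto simp: add_submonoid_def)
  have finT: "finite T" "finite (G \<inter> S)" using fin by (auto simp: T_def)
  have disj: "convex hull (real_vec ` T) \<inter> L = {}"
  proof (rule ccontr)
    assume "convex hull (real_vec ` T) \<inter> L \<noteq> {}"
    then obtain x where x: "x \<in> convex hull (real_vec ` T)" "x \<in> L" by blast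
    obtain l where l: "\<forall>y\<in>real_vec ` T. 0 \<le> l y" "sum l (real_vec ` T) = 1"
      "(\<Sum>y\<in>real_vec ` T. l y *\<^sub>R y) = x"
      using x(1) finT by (auto simp: convex_hull_finite)
    obtain m where m: "(\<Sum>y\<in>real_vec ` (G \<inter> S). m y *\<^sub>R y) = x"
      using x(2) finT by (auto simp: L_def span_finite)
    have inj: "inj_on real_vec X" for X :: "(int ^ 'd) set"
      using inj_real_vec inj_on_subset by blast
    \<comment> \<open>Difference of the two representations of \<open>x\<close>: the hull
      coefficients are nonnegative, while those from the span, of either sign, sit only on
      generators in \<open>S\<close>.\<close>
    define c where "c g = (if g \<in> S then - m (real_vec g) else l (real_vec g))" for g
    have G: "G = T \<union> (G \<inter> S)" "T \<inter> (G \<inter> S) = {}" by (auto simp: T_def)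
    have "(\<Sum>g\<in>G. c g *\<^sub>R real_vec g)
        = (\<Sum>g\<in>T. c g *\<^sub>R real_vec g) + (\<Sum>g\<in>G \<inter> S. c g *\<^sub>R real_vec g)"
      using sum.union_disjoint[OF finT G(2)] G(1) by simp
    also have "(\<Sum>g\<in>T. c g *\<^sub>R real_vec g) = (\<Sum>g\<in>T. l (real_vec g) *\<^sub>R real_vec g)"
      by (intro sum.cong) (auto simp: c_def T_def)
    also have "\<dots> = x" using l(3) by (simp add: sum.reindex[OF inj])
    also have "(\<Sum>g\<in>G \<inter> S. c g *\<^sub>R real_vec g) = - (\<Sum>g\<in>G \<inter> S. m (real_vec g) *\<^sub>R real_vec g)"
      unfolding sum_negf[symmetric] by (intro sum.cong) (auto simp: c_def)
    also have "\<dots> = - x" using m by (simp add: sum.reindex[OF inj])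
    finally have "(\<Sum>g\<in>G. c g *\<^sub>R real_vec g) = 0" by simp
    then obtain p :: "int ^ 'd \<Rightarrow> int" where p: "(\<Sum>g\<in>G. p g *s g) = 0"
      "\<And>g. g \<in> G \<Longrightarrow> 0 \<le> c g \<Longrightarrow> 0 \<le> p g"
      "\<And>g. g \<in> G \<Longrightarrow> 0 < c g \<Longrightarrow> 0 < p g"
      using integer_relation_from_real[OF fin] by blast
    have "\<exists>t\<in>T. l (real_vec t) > 0"
    proof (rule ccontr)
      assume "\<not> ?thesis"
      then have "sum l (real_vec ` T) \<le> 0" by (intro sum_nonpos) auto
      with l(2) show False by simp
    qed
    then obtain t where t: "t \<in> T" "l (real_vec t) > 0" by blast
    then have tG: "t \<in> G" "t \<notin> S" by (auto simp: T_def)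
    have pT: "p g \<ge> 0" if "g \<in> G" "g \<notin> S" for g
      using p(2)[of g] l(1) that by (auto simp: c_def T_def)
    have pt: "p t > 0" using p(3)[of t] t tG by (simp add: c_def)
    \<comment> \<open>Positive part of the integer relation. Its negative part \<open>z\<close>
      involves only generators in \<open>S\<close>, because \<open>p\<close> is nonnegative
      elsewhere; so \<open>z\<close> lies in \<open>M \<inter> S\<close>.\<close>
    define y where "y = (\<Sum>g\<in>G. max (p g) 0 *s g)"
    define z where "z = (\<Sum>g\<in>G \<inter> S. max (- p g) 0 *s g)"
    \<comment> \<open>This is \<open>y\<close> with one copy of \<open>t\<close> removed; the
      coefficients stay nonnegative since \<open>p t\<close> is at least 1. Thus
      \<open>w + t = z\<close> is in \<open>S\<close>, and \<open>face\<close> puts \<open>t\<close>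
      there.\<close>
    define w where "w = (\<Sum>g\<in>G. (max (p g) 0 - of_bool (g = t)) *s g)"
    have "z = (\<Sum>g\<in>G. max (- p g) 0 *s g)"
      unfolding z_def by (rule sum.mono_neutral_left) (use fin pT in \<open>auto simp: max_def\<close>)
    moreover have "y - (\<Sum>g\<in>G. max (- p g) 0 *s g) = (\<Sum>g\<in>G. p g *s g)"
      unfolding y_def sum_subtractf[symmetric]
      by (intro sum.cong) (auto simp: max_def vec_eq_iff)
    ultimately have "y = z" using p(1) by simp
    moreover have "z \<in> M \<inter> S"
      unfolding z_def using GM by (intro add_submonoid_combination[OF MS]) auto
    moreover have "w \<in> M"
      unfolding w_def using GM pt by (intro add_submonoid_combination[OF M]) auto
    moreover have "w + t = y"
    proof -
      have "(\<Sum>g\<in>G. of_bool (g = t) *s g) = (\<Sum>g\<in>G. if g = t then g else 0)"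
        by (intro sum.cong) auto
      also have "\<dots> = t" using fin tG by simp
      finally have "w = y - t"
        by (simp add: w_def y_def sum_subtractf vec_eq_iff algebra_simps sum_component)
      then show ?thesis by simp
    qed
    ultimately have "t \<in> S" using face[of w t] GM tG(1) by auto
    with tG show False by simp
  qed
  obtain u where u: "\<And>g. g \<in> T \<Longrightarrow> u \<bullet> real_vec g < 0" "\<And>g. g \<in> G \<inter> S \<Longrightarrow> u \<bullet> real_vec g = 0"
  proof (cases "T = {}")
    case True
    \<comment> \<open>All generators lie in \<open>S\<close>, so the zero functional serves.\<close>
    then show ?thesis using that[of 0] by auto
  next
    case False
    have "compact (convex hull (real_vec ` T))"
      using finT by (intro compact_convex_hull finite_imp_compact) auto
    moreover have "closed L" "convex L" "0 \<in> L"
      unfolding L_def by (auto intro: closed_subspace span_zero subspace_imp_convex)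
    ultimately obtain a b where ab: "\<forall>x\<in>convex hull (real_vec ` T). a \<bullet> x < b" "\<forall>x\<in>L. a \<bullet> x > b"
      using separating_hyperplane_compact_closed[of "convex hull (real_vec ` T)" L] disj False
      by (auto simp: convex_convex_hull)
    have "b < 0" using ab(2) \<open>0 \<in> L\<close> by fastforce
    have "a \<bullet> x = 0" if x: "x \<in> L" for x
    proof (rule ccontr)
      assume n: "a \<bullet> x \<noteq> 0"
      \<comment> \<open>A functional bounded below on a subspace vanishes there: this multiple of
        \<open>x\<close> would take exactly the excluded value \<open>b\<close>.\<close>
      have "(b / (a \<bullet> x)) *\<^sub>R x \<in> L" using x unfolding L_def by (rule span_mul)
      from ab(2)[rule_format, OF this] n show False by simp
    qed
    moreover have "real_vec g \<in> L" if "g \<in> G \<inter> S" for g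
      unfolding L_def using that by (intro span_base imageI)
    moreover have "a \<bullet> real_vec g < 0" if "g \<in> T" for g
      using ab(1) \<open>b < 0\<close> hull_inc[of "real_vec g" "real_vec ` T" convex] that by force
    ultimately show ?thesis using that[of a] by blast
  qed
  have "a \<in> M \<and> u \<bullet> real_vec a \<le> 0 \<and> (u \<bullet> real_vec a = 0 \<longleftrightarrow> a \<in> S)" if "a \<in> M" for a
  proof -
    let ?P = "\<lambda>a. a \<in> M \<and> u \<bullet> real_vec a \<le> 0 \<and> (u \<bullet> real_vec a = 0 \<longleftrightarrow> a \<in> S)"
    \<comment> \<open>Two nonpositive values add to 0 only if both are 0, which matches
      \<open>face\<close>. Membership in \<open>M\<close> is part of \<open>?P\<close> because
      \<open>face\<close> speaks only about \<open>M\<close>.\<close>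
    have "add_submonoid {a. ?P a}"
      using M S0 face by (auto simp: add_submonoid_def inner_add_right)
    moreover have "G \<subseteq> {a. ?P a}"
      using u GM by (force simp: T_def)
    ultimately have "M \<subseteq> {a. ?P a}" unfolding M_def by (rule hull_minimal[rotated])
    then show ?thesis using that by blast
  qed
  then show ?thesis using that by blast
qed

section \<open>Restricted subfans\<close>

text \<open>\<open>cone_face\<close> admits supporting hyperplanes at any level \<open>r\<close>. In
  a cone that level must be 0, and two nonpositive values with sum 0 are both 0.\<close>

lemma cone_face_addD:
  assumes "convex_cone C" "cone_face F C" "x \<in> C" "y \<in> C" "x + y \<in> F"
  shows "x \<in> F \<and> y \<in> F"
proof (cases "F = C")
  case True
  then show ?thesis using assms by simp
next
  case False
  then obtain u r where ur: "C \<subseteq> {x. u \<bullet> x \<le> r}" "F = C \<inter> {x. u \<bullet> x = r}"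
    using assms(2) by (auto simp: cone_face_def)
  have "0 \<in> C" using assms(1) by (rule convex_cone_contains_0)
  have "x + y \<in> C" using assms(1,3,4) by (rule convex_cone_add)
  \<comment> \<open>The origin gives \<open>0 \<le> r\<close>, and the doubled point gives
    \<open>2 * r \<le> r\<close>; hence \<open>r = 0\<close>.\<close>
  then have "(x + y) + (x + y) \<in> C" using convex_cone_add[OF assms(1)] by blast
  then have "u \<bullet> 0 \<le> r" "u \<bullet> ((x + y) + (x + y)) \<le> r" using ur(1) \<open>0 \<in> C\<close> by blast+
  moreover have "u \<bullet> (x + y) = r" "u \<bullet> x \<le> r" "u \<bullet> y \<le> r" using ur assms by auto
  ultimately have "u \<bullet> x = r" "u \<bullet> y = r" unfolding inner_add_right by simp_all
  then show ?thesis using ur assms by simp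
qed

section \<open>Cones and monoids of a fixed monoidal complex\<close>

locale fan_complex =
  fixes \<Sigma> :: "(real ^ 'd::finite) set set" and M :: "(real ^ 'd) set \<Rightarrow> (int ^ 'd) set"
  assumes fan: "rational_pointed_fan \<Sigma>" and cpx: "monoidal_complex \<Sigma> M"
begin

lemma cone:
  assumes "C \<in> \<Sigma>"
  shows "convex_cone C"
proof -
  have "rational_cone C" using fan assms by (simp add: rational_pointed_fan_def)
  then show ?thesis using convex_cone_convex_cone_hull by (auto simp: rational_cone_def)
qed

lemma face_closed:
  assumes "C \<in> \<Sigma>" "cone_face F C"
  shows "F \<in> \<Sigma>"
proof -
  have "\<forall>C\<in>\<Sigma>. \<forall>F. cone_face F C \<longrightarrow> F \<in> \<Sigma>"
    using fan unfolding rational_pointed_fan_def by (elim conjE)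
  from this[rule_format, OF assms] show ?thesis .
qed

text \<open>The empty alternative in the definition of a fan never occurs, as every cone contains
  the origin.\<close>

lemma Int_face:
  assumes "C \<in> \<Sigma>" "D \<in> \<Sigma>"
  shows "cone_face (C \<inter> D) C"
proof -
  have "0 \<in> C \<inter> D" using assms cone convex_cone_contains_0 by blast
  moreover have "C \<inter> D = {} \<or> cone_face (C \<inter> D) C"
    using assms fan unfolding rational_pointed_fan_def by meson
  ultimately show ?thesis by blast
qed

lemma zero_cone: "{0} \<in> \<Sigma>"
proof -
  obtain C where "C \<in> \<Sigma>" using fan unfolding rational_pointed_fan_def by blast
  moreover from this have "cone_face {0} C"
    using fan by (simp add: rational_pointed_fan_def pointed_cone_def)
  ultimately show ?thesis by (rule face_closed)
qed

lemma affine_monoid: "C \<in> \<Sigma> \<Longrightarrow> affine_monoid (M C)"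
  and real_vec_image: "C \<in> \<Sigma> \<Longrightarrow> real_vec ` M C \<subseteq> C"
  and hull_monoid: "C \<in> \<Sigma> \<Longrightarrow> convex_cone hull (real_vec ` M C) = C"
  and monoid_subset: "C \<in> \<Sigma> \<Longrightarrow> D \<in> \<Sigma> \<Longrightarrow> D \<subseteq> C \<Longrightarrow> M D = {a \<in> M C. real_vec a \<in> D}"
proof -
  note * = cpx[unfolded monoidal_complex_def, THEN conjunct1]
    and sub = cpx[unfolded monoidal_complex_def, THEN conjunct2]
  show "affine_monoid (M C)" "real_vec ` M C \<subseteq> C" "convex_cone hull (real_vec ` M C) = C"
    if "C \<in> \<Sigma>"
    using *[rule_format, OF that] by blast+
  show "M D = {a \<in> M C. real_vec a \<in> D}" if "C \<in> \<Sigma>" "D \<in> \<Sigma>" "D \<subseteq> C"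
    by (rule sub[rule_format, OF that])
qed

lemma monoid: "C \<in> \<Sigma> \<Longrightarrow> add_submonoid (M C)"
  using affine_monoid[unfolded affine_monoid_def] add_submonoid_hull by metis

lemma monoid_0:
  assumes "C \<in> \<Sigma>"
  shows "0 \<in> M C"
  using monoid[OF assms] by (simp add: add_submonoid_def)

lemma monoid_add:
  assumes "C \<in> \<Sigma>" "a \<in> M C" "b \<in> M C"
  shows "a + b \<in> M C"
  using monoid[OF assms(1)] assms(2,3) by (simp add: add_submonoid_def)

lemma real_vec_in: "C \<in> \<Sigma> \<Longrightarrow> a \<in> M C \<Longrightarrow> real_vec a \<in> C"
  using real_vec_image by blast

lemma zero_cone_monoid: "M {0} = {0}"
  using real_vec_in[OF zero_cone] monoid_0[OF zero_cone] by auto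

text \<open>Both monoids induce the same monoid on the common face \<open>C \<inter> D\<close>, so
  an exponent can be moved between cones that contain it.\<close>

lemma monoid_transfer:
  assumes "C \<in> \<Sigma>" "D \<in> \<Sigma>" "a \<in> M C" "real_vec a \<in> D"
  shows "a \<in> M D"
proof -
  have "C \<inter> D \<in> \<Sigma>" using Int_face face_closed assms by blast
  then have "a \<in> M (C \<inter> D)"
    using assms real_vec_in monoid_subset[of C "C \<inter> D"] by auto
  then show ?thesis using \<open>C \<inter> D \<in> \<Sigma>\<close> assms monoid_subset[of D "C \<inter> D"] by auto
qed

text \<open>Restrictedness is applied to a two-point set. This makes the products over
  \<open>\<Gamma>\<close> and over \<open>\<Sigma>\<close> agree.\<close>

lemma restricted_common_cone:
  assumes \<Gamma>: "restricted_subfan \<Gamma> \<Sigma>"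
    and ab: "a \<in> complex_support \<Gamma> M" "b \<in> complex_support \<Gamma> M"
    and C: "C \<in> \<Sigma>" "a \<in> M C" "b \<in> M C"
  shows "\<exists>D\<in>\<Gamma>. a \<in> M D \<and> b \<in> M D"
proof -
  have sub: "\<Gamma> \<subseteq> \<Sigma>" using \<Gamma> by (auto simp: restricted_subfan_def subfan_def)
  let ?X = "{real_vec a, real_vec b}"
  have \<Gamma>X: "finite X \<Longrightarrow> X \<subseteq> \<Union>\<Gamma> \<Longrightarrow> X \<subseteq> C \<Longrightarrow> \<exists>D\<in>\<Gamma>. X \<subseteq> D" for X
    using \<Gamma> C(1) unfolding restricted_subfan_def by blast
  obtain D E where DE: "D \<in> \<Gamma>" "a \<in> M D" "E \<in> \<Gamma>" "b \<in> M E"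
    using ab by (auto simp: complex_support_def)
  then have "real_vec a \<in> D" "real_vec b \<in> E" using sub real_vec_in by blast+
  with DE have "?X \<subseteq> \<Union>\<Gamma>" by blast
  moreover have "?X \<subseteq> C" using real_vec_in C by blast
  ultimately obtain F where F: "F \<in> \<Gamma>" "?X \<subseteq> F" using \<Gamma>X[of ?X] by blast
  then have "F \<in> \<Sigma>" using sub by blast
  then have "a \<in> M F" "b \<in> M F" using F(2) C monoid_transfer[OF C(1)] by blast+
  then show ?thesis using F(1) by blast
qed

text \<open>For a cone \<open>D\<close> of \<open>\<Gamma>\<close> containing the sum,
  \<open>C \<inter> D\<close> is a face of \<open>C\<close>, and faces contain the summands of their
  elements. Hence the monomials outside \<open>\<Gamma>\<close> span an ideal, which makes
  restriction multiplicative.\<close>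

lemma subfan_support_addD:
  assumes "\<Gamma> \<subseteq> \<Sigma>" "C \<in> \<Sigma>" "a \<in> M C" "b \<in> M C" "a + b \<in> complex_support \<Gamma> M"
  shows "a \<in> complex_support \<Gamma> M \<and> b \<in> complex_support \<Gamma> M"
proof -
  obtain D where D: "D \<in> \<Gamma>" "a + b \<in> M D" using assms(5) by (auto simp: complex_support_def)
  then have D': "D \<in> \<Sigma>" using assms(1) by blast
  have "real_vec a + real_vec b \<in> C \<inter> D"
    using real_vec_in[OF D' D(2)] real_vec_in[OF assms(2) monoid_add[OF assms(2-4)]] by simp
  then have "real_vec a \<in> C \<inter> D \<and> real_vec b \<in> C \<inter> D"
    by (rule cone_face_addD[OF cone[OF assms(2)] Int_face[OF assms(2) D']
          real_vec_in[OF assms(2,3)] real_vec_in[OF assms(2,4)]])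
  then have "a \<in> M D" "b \<in> M D"
    using monoid_transfer[OF assms(2) D'] assms(3,4) by blast+
  then show ?thesis using D(1) by (auto simp: complex_support_def)
qed

text \<open>The functional from \<open>monoid_face_exposed\<close> is nonpositive on
  \<open>M C\<close>, hence on the cone it generates. Its zero set then supports \<open>C\<close> in
  a face, which belongs to the fan, and compatibility of the monoids identifies the monoid of that
  face.\<close>

lemma monoid_face_subcone:
  assumes C: "C \<in> \<Sigma>" and S0: "0 \<in> S"
    and face: "\<And>a b. a \<in> M C \<Longrightarrow> b \<in> M C \<Longrightarrow> a + b \<in> S \<longleftrightarrow> a \<in> S \<and> b \<in> S"
  obtains F where "F \<in> \<Sigma>" "F \<subseteq> C" "M F = M C \<inter> S"
proof -
  obtain G where G: "finite G" "M C = add_submonoid hull G"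
    using affine_monoid[OF C] by (auto simp: affine_monoid_def)
  obtain u where u: "\<And>a. a \<in> M C \<Longrightarrow> u \<bullet> real_vec a \<le> 0"
    "\<And>a. a \<in> M C \<Longrightarrow> u \<bullet> real_vec a = 0 \<longleftrightarrow> a \<in> S"
    using monoid_face_exposed[OF G(1) S0] face G(2) by metis
  define F where "F = C \<inter> {x. u \<bullet> x = 0}"
  have "convex_cone {x. u \<bullet> x \<le> 0}"
    by (rule convex_cone_halfspace_le)
  then have "C \<subseteq> {x. u \<bullet> x \<le> 0}"
    using u(1) hull_minimal[of "real_vec ` M C" "{x. u \<bullet> x \<le> 0}" convex_cone] hull_monoid[OF C]
    by auto
  moreover have "0 \<in> F" using C cone convex_cone_contains_0 by (auto simp: F_def)
  \<comment> \<open>A hyperplane needs a nonzero normal; for \<open>u = 0\<close> the set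
    \<open>F\<close> is \<open>C\<close> itself.\<close>
  ultimately have "cone_face F C"
    unfolding cone_face_def F_def by (cases "u = 0") auto
  then have "F \<in> \<Sigma>" using C face_closed by blast
  moreover have "M F = M C \<inter> S"
    using monoid_subset[OF C \<open>F \<in> \<Sigma>\<close>] u(2) real_vec_in[OF C] by (auto simp: F_def)
  ultimately show ?thesis using that F_def by blast
qed

text \<open>The cones whose monoid lies in \<open>S\<close> are closed under passing to faces.
  Inside each cone \<open>C\<close>, the face with monoid \<open>M C \<inter> S\<close> contains
  everything that \<open>\<Gamma>\<close> covers in \<open>C\<close>, which yields
  restrictedness.\<close>

lemma restricted_subfan_of_face:
  assumes S0: "0 \<in> S" and S: "S \<subseteq> complex_support \<Sigma> M"
    and face: "\<And>C a b. C \<in> \<Sigma> \<Longrightarrow> a \<in> M C \<Longrightarrow> b \<in> M C \<Longrightarrow> a + b \<in> S \<longleftrightarrow> a \<in> S \<and> b \<in> S"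
  obtains \<Gamma> where "restricted_subfan \<Gamma> \<Sigma>" "complex_support \<Gamma> M = S"
proof -
  define \<Gamma> where "\<Gamma> = {C \<in> \<Sigma>. M C \<subseteq> S}"
  have sub: "\<Gamma> \<subseteq> \<Sigma>" by (auto simp: \<Gamma>_def)
  have down: "F \<in> \<Gamma>" if "C \<in> \<Gamma>" "F \<in> \<Sigma>" "F \<subseteq> C" for F C
    using that monoid_subset[of C F] by (auto simp: \<Gamma>_def)
  have face_sub: "F \<subseteq> C" if "cone_face F C" for F C :: "(real ^ 'd) set"
    using that by (auto simp: cone_face_def)
  have "{0} \<in> \<Gamma>" using zero_cone zero_cone_monoid S0 by (simp add: \<Gamma>_def)
  moreover have "F \<in> \<Gamma>" if "C \<in> \<Gamma>" "cone_face F C" for F C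
    using down[OF that(1)] face_closed face_sub that sub by blast
  moreover have "finite \<Sigma> \<and> (\<forall>C\<in>\<Sigma>. pointed_cone C \<and> rational_cone C)"
    using fan unfolding rational_pointed_fan_def by (elim conjE, intro conjI)
  then have "finite \<Gamma>" "\<forall>C\<in>\<Gamma>. pointed_cone C \<and> rational_cone C"
    using sub finite_subset[OF sub] by blast+
  moreover have "cone_face (C \<inter> D) C \<and> cone_face (C \<inter> D) D" if "C \<in> \<Gamma>" "D \<in> \<Gamma>" for C D
    using that sub Int_face[of C D] Int_face[of D C] by (auto simp: Int_commute)
  ultimately have "rational_pointed_fan \<Gamma>"
    using \<open>{0} \<in> \<Gamma>\<close> unfolding rational_pointed_fan_def by (intro conjI ballI allI impI disjI2) blast+
  then have "subfan \<Gamma> \<Sigma>" using sub by (simp add: subfan_def)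
  moreover have "\<exists>D\<in>\<Gamma>. X \<subseteq> D" if X: "X \<subseteq> \<Union>\<Gamma>" "C \<in> \<Sigma>" "X \<subseteq> C" for X C
  proof -
    obtain F where F: "F \<in> \<Sigma>" "F \<subseteq> C" "M F = M C \<inter> S"
      using monoid_face_subcone[OF X(2) S0 face[OF X(2)]] by blast
    have "x \<in> F" if x: "x \<in> X" for x
    proof -
      \<comment> \<open>The face \<open>C \<inter> E\<close> is again in \<open>\<Gamma>\<close>, so
        its monoid lies in \<open>M C \<inter> S = M F\<close>. Passing to the generated cones
        carries this from lattice points to the real point \<open>x\<close>.\<close>
      obtain E where E: "E \<in> \<Gamma>" "x \<in> E" "x \<in> C" using X x by blast
      then have EC: "C \<inter> E \<in> \<Sigma>" using face_closed[OF X(2) Int_face[OF X(2)]] sub by blast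
      then have "C \<inter> E \<in> \<Gamma>" using down E(1) by blast
      then have "M (C \<inter> E) \<subseteq> M F"
        using F(3) monoid_subset[OF X(2) EC] by (auto simp: \<Gamma>_def)
      then have "convex_cone hull (real_vec ` M (C \<inter> E)) \<subseteq> convex_cone hull (real_vec ` M F)"
        by (intro hull_mono image_mono)
      then show ?thesis using hull_monoid[OF EC] hull_monoid[OF F(1)] E by blast
    qed
    moreover have "F \<in> \<Gamma>" using F by (simp add: \<Gamma>_def)
    ultimately show ?thesis by blast
  qed
  ultimately have "restricted_subfan \<Gamma> \<Sigma>" unfolding restricted_subfan_def by blast
  moreover have "complex_support \<Gamma> M = S"
  proof
    show "complex_support \<Gamma> M \<subseteq> S" by (auto simp: complex_support_def \<Gamma>_def)
    show "S \<subseteq> complex_support \<Gamma> M"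
    proof
      fix a assume a: "a \<in> S"
      then obtain C where C: "C \<in> \<Sigma>" "a \<in> M C" using S by (auto simp: complex_support_def)
      obtain F where F: "F \<in> \<Sigma>" "F \<subseteq> C" "M F = M C \<inter> S"
        using monoid_face_subcone[OF C(1) S0 face[OF C(1)]] by blast
      then show "a \<in> complex_support \<Gamma> M" using a C by (auto simp: complex_support_def \<Gamma>_def)
    qed
  qed
  ultimately show ?thesis using that by blast
qed

end

section \<open>Graded homomorphisms of toric face rings\<close>

lemma graded_algebra_hom_comp:
  assumes "g \<in> graded_algebra_hom K B \<B> C \<C>" "f \<in> graded_algebra_hom K A \<A> B \<B>"
  shows "g \<circ> f \<in> graded_algebra_hom K A \<A> C \<C>"
proof -
  have "f x \<in> carrier B" if "x \<in> carrier A" for x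
    using assms(2) that by (auto simp: graded_algebra_hom_def ring_hom_def)
  moreover have "g \<circ> f \<in> ring_hom A C"
    using assms by (auto simp: graded_algebra_hom_def intro: ring_hom_trans)
  moreover have "(g \<circ> f) ` \<A> a \<subseteq> \<C> a" for a
    using assms unfolding graded_algebra_hom_def image_comp[symmetric] by blast
  ultimately show ?thesis
    using assms by (simp add: graded_algebra_hom_def)
qed

section \<open>Elements and monomials of toric face rings\<close>

locale toric_complex = fan_complex \<Sigma> M + field K
  for K :: "('k, 'r) ring_scheme" (structure)
    and \<Sigma> :: "(real ^ 'd::finite) set set" and M :: "(real ^ 'd) set \<Rightarrow> (int ^ 'd) set"
begin

abbreviation "T \<Gamma> \<equiv> toric_face_ring K \<Gamma> M"
abbreviation "Gr \<Gamma> \<equiv> toric_grading K \<Gamma> M"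
abbreviation "supp \<Gamma> \<equiv> complex_support \<Gamma> M"

lemma toric_carrier_iff:
  "f \<in> carrier (T \<Gamma>) \<longleftrightarrow> (\<forall>a. f a \<in> carrier K) \<and> finite {a. f a \<noteq> \<zero>} \<and> (\<forall>a. a \<notin> supp \<Gamma> \<longrightarrow> f a = \<zero>)"
  by (auto simp: toric_face_ring_def)

lemma toric_one: "\<one>\<^bsub>T \<Gamma>\<^esub> = toric_monom K 0"
  and toric_add: "f \<oplus>\<^bsub>T \<Gamma>\<^esub> g = (\<lambda>a. f a \<oplus> g a)"
  and toric_smult: "c \<odot>\<^bsub>T \<Gamma>\<^esub> f = (\<lambda>a. c \<otimes> f a)"
  by (simp_all add: toric_face_ring_def toric_monom_def)

lemma toric_mult:
  "(f \<otimes>\<^bsub>T \<Gamma>\<^esub> g) c = finsum K (\<lambda>(a, b). f a \<otimes> g b)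
      {(a, b). f a \<noteq> \<zero> \<and> g b \<noteq> \<zero> \<and> a + b = c \<and> (\<exists>C\<in>\<Gamma>. a \<in> M C \<and> b \<in> M C)}"
  by (simp add: toric_face_ring_def)

lemma toric_grading_iff:
  "f \<in> Gr \<Gamma> a \<longleftrightarrow> f \<in> carrier (T \<Gamma>) \<and> (\<forall>b. b \<noteq> a \<longrightarrow> f b = \<zero>)"
  by (simp add: toric_grading_def)

lemma toric_zero_carrier: "(\<lambda>a. \<zero>) \<in> carrier (T \<Gamma>)"
  by (simp add: toric_carrier_iff)

lemma toric_single_grading:
  assumes "a \<in> supp \<Gamma>" "c \<in> carrier K"
  shows "(\<lambda>b. if b = a then c else \<zero>) \<in> Gr \<Gamma> a"
proof -
  have "{b. (if b = a then c else \<zero>) \<noteq> \<zero>} \<subseteq> {a}" by auto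
  then have "finite {b. (if b = a then c else \<zero>) \<noteq> \<zero>}" by (rule finite_subset) simp
  then show ?thesis using assms by (auto simp: toric_grading_iff toric_carrier_iff)
qed

lemma toric_monom_grading: "a \<in> supp \<Gamma> \<Longrightarrow> toric_monom K a \<in> Gr \<Gamma> a"
  unfolding toric_monom_def by (rule toric_single_grading) simp_all

lemma toric_monom_carrier: "a \<in> supp \<Gamma> \<Longrightarrow> toric_monom K a \<in> carrier (T \<Gamma>)"
  using toric_monom_grading by (simp add: toric_grading_iff)

text \<open>Replaces the expansion into monomials: an induction over a finite set bounding the
  support removes one coefficient at a time.\<close>

lemma toric_induct [consumes 1, case_names zero single add]:
  assumes f: "f \<in> carrier (T \<Gamma>)"
    and zero: "P (\<lambda>a. \<zero>)"
    and single: "\<And>a c. a \<in> supp \<Gamma> \<Longrightarrow> c \<in> carrier K \<Longrightarrow> P (\<lambda>b. if b = a then c else \<zero>)"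
    and add: "\<And>f g. f \<in> carrier (T \<Gamma>) \<Longrightarrow> g \<in> carrier (T \<Gamma>) \<Longrightarrow> P f \<Longrightarrow> P g \<Longrightarrow> P (\<lambda>a. f a \<oplus> g a)"
  shows "P f"
proof -
  have "finite X \<Longrightarrow> {a. f a \<noteq> \<zero>} \<subseteq> X \<Longrightarrow> f \<in> carrier (T \<Gamma>) \<Longrightarrow> P f" for X f
  proof (induction X arbitrary: f rule: finite_induct)
    case empty
    then have "f = (\<lambda>a. \<zero>)" by auto
    then show ?case using zero by simp
  next
    case (insert x X)
    let ?g = "\<lambda>b. if b = x then \<zero> else f b"
    let ?h = "\<lambda>b. if b = x then f x else \<zero>"
    have car: "f a \<in> carrier K" for a using insert.prems by (simp add: toric_carrier_iff)
    have "{a. ?g a \<noteq> \<zero>} \<subseteq> {a. f a \<noteq> \<zero>}" by auto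
    then have "finite {a. ?g a \<noteq> \<zero>}"
      by (rule finite_subset) (use insert.prems in \<open>simp add: toric_carrier_iff\<close>)
    then have g: "?g \<in> carrier (T \<Gamma>)" using insert.prems by (auto simp: toric_carrier_iff)
    have "P ?g" by (rule insert.IH) (use insert.prems g in auto)
    show ?case
    proof (cases "x \<in> supp \<Gamma>")
      case True
      have "?h \<in> carrier (T \<Gamma>)"
        using toric_single_grading[OF True car] by (simp add: toric_grading_iff)
      from add[OF g this \<open>P ?g\<close> single[OF True car]]
      have "P (\<lambda>a. ?g a \<oplus> ?h a)" .
      moreover have "(\<lambda>a. ?g a \<oplus> ?h a) = f" using car by auto
      ultimately show ?thesis by simp
    next
      case False
      \<comment> \<open>Outside the support of the complex the coefficient at \<open>x\<close> is
        already zero, so nothing is removed.\<close>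
      then have "?g = f" using insert.prems by (auto simp: toric_carrier_iff)
      then show ?thesis using \<open>P ?g\<close> by simp
    qed
  qed
  then show ?thesis using f by (auto simp: toric_carrier_iff)
qed

lemma toric_monom_mult:
  assumes "C \<in> \<Gamma>" "a \<in> M C" "b \<in> M C"
  shows "toric_monom K a \<otimes>\<^bsub>T \<Gamma>\<^esub> toric_monom K b = toric_monom K (a + b)"
proof -
  have "\<exists>C\<in>\<Gamma>. a \<in> M C \<and> b \<in> M C" using assms by blast
  then show ?thesis by (simp only: toric_face_ring_mult_monom[OF field_axioms] if_True)
qed

section \<open>Inclusion and restriction for a restricted subfan\<close>

lemma supp_mono: "\<Gamma> \<subseteq> \<Delta> \<Longrightarrow> supp \<Gamma> \<subseteq> supp \<Delta>"
  by (auto simp: complex_support_def)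

lemma toric_carrier_mono: "\<Gamma> \<subseteq> \<Delta> \<Longrightarrow> f \<in> carrier (T \<Gamma>) \<Longrightarrow> f \<in> carrier (T \<Delta>)"
  using supp_mono[of \<Gamma> \<Delta>] unfolding toric_carrier_iff by blast

text \<open>For exponents in the support of \<open>\<Gamma>\<close>, a common cone in
  \<open>\<Sigma>\<close> yields one in \<open>\<Gamma>\<close>; so both products sum over the same
  pairs.\<close>

lemma toric_mult_restricted:
  assumes \<Gamma>: "restricted_subfan \<Gamma> \<Sigma>" and f: "f \<in> carrier (T \<Gamma>)" and g: "g \<in> carrier (T \<Gamma>)"
  shows "f \<otimes>\<^bsub>T \<Gamma>\<^esub> g = f \<otimes>\<^bsub>T \<Sigma>\<^esub> g"
proof
  fix c
  have sub: "\<Gamma> \<subseteq> \<Sigma>" using \<Gamma> by (simp add: restricted_subfan_def subfan_def)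
  have "(\<exists>C\<in>\<Gamma>. a \<in> M C \<and> b \<in> M C) \<longleftrightarrow> (\<exists>C\<in>\<Sigma>. a \<in> M C \<and> b \<in> M C)"
    if "f a \<noteq> \<zero>" "g b \<noteq> \<zero>" for a b
  proof -
    have "a \<in> supp \<Gamma>" "b \<in> supp \<Gamma>" using that f g by (auto simp: toric_carrier_iff)
    then show ?thesis using restricted_common_cone[OF \<Gamma>] sub by blast
  qed
  then have "{(a, b). f a \<noteq> \<zero> \<and> g b \<noteq> \<zero> \<and> a + b = c \<and> (\<exists>C\<in>\<Gamma>. a \<in> M C \<and> b \<in> M C)}
      = {(a, b). f a \<noteq> \<zero> \<and> g b \<noteq> \<zero> \<and> a + b = c \<and> (\<exists>C\<in>\<Sigma>. a \<in> M C \<and> b \<in> M C)}"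
    by (intro Collect_cong) (auto split: prod.splits)
  then show "(f \<otimes>\<^bsub>T \<Gamma>\<^esub> g) c = (f \<otimes>\<^bsub>T \<Sigma>\<^esub> g) c"
    unfolding toric_mult by simp
qed

lemma toric_inclusion_hom:
  assumes \<Gamma>: "restricted_subfan \<Gamma> \<Sigma>"
  shows "(\<lambda>f. f) \<in> graded_algebra_hom K (T \<Gamma>) (Gr \<Gamma>) (T \<Sigma>) (Gr \<Sigma>)"
proof -
  have sub: "\<Gamma> \<subseteq> \<Sigma>" using \<Gamma> by (simp add: restricted_subfan_def subfan_def)
  have "(\<lambda>f. f) \<in> ring_hom (T \<Gamma>) (T \<Sigma>)"
    by (rule ring_hom_memI)
      (simp_all add: toric_carrier_mono[OF sub] toric_mult_restricted[OF \<Gamma>] toric_add toric_one)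
  then show ?thesis
    using toric_carrier_mono[OF sub]
    by (auto simp: graded_algebra_hom_def toric_smult toric_grading_iff)
qed

text \<open>A coordinate projection. With \<open>S = supp \<Gamma>\<close> it is the retraction onto
  the ring of the subfan; for general \<open>S\<close> it describes the idempotent of a given
  retract.\<close>

definition restrict_coeffs :: "(int ^ 'd) set \<Rightarrow> (int ^ 'd \<Rightarrow> 'k) \<Rightarrow> int ^ 'd \<Rightarrow> 'k" where
  "restrict_coeffs S f = (\<lambda>a. if a \<in> S then f a else \<zero>)"

lemma restrict_coeffs_carrier:
  assumes "f \<in> carrier (T \<Delta>)"
  shows "restrict_coeffs (supp \<Gamma>) f \<in> carrier (T \<Gamma>)"
proof -
  have "{a. restrict_coeffs (supp \<Gamma>) f a \<noteq> \<zero>} \<subseteq> {a. f a \<noteq> \<zero>}"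
    by (auto simp: restrict_coeffs_def)
  then have "finite {a. restrict_coeffs (supp \<Gamma>) f a \<noteq> \<zero>}"
    by (rule finite_subset) (use assms in \<open>simp add: toric_carrier_iff\<close>)
  then show ?thesis using assms by (auto simp: toric_carrier_iff restrict_coeffs_def)
qed

lemma restrict_coeffs_id: "f \<in> carrier (T \<Gamma>) \<Longrightarrow> restrict_coeffs (supp \<Gamma>) f = f"
  by (auto simp: toric_carrier_iff restrict_coeffs_def)

text \<open>At a degree in the support of \<open>\<Gamma>\<close>, only pairs with both exponents in
  that support contribute, as it contains the summands of its elements. At any other degree the
  product over \<open>\<Gamma>\<close> has no contributions, since each monoid is closed under
  addition.\<close>

lemma restrict_coeffs_mult:
  assumes \<Gamma>: "restricted_subfan \<Gamma> \<Sigma>" and f: "f \<in> carrier (T \<Sigma>)" and g: "g \<in> carrier (T \<Sigma>)"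
  defines "r \<equiv> restrict_coeffs (supp \<Gamma>)"
  shows "r (f \<otimes>\<^bsub>T \<Sigma>\<^esub> g) = r f \<otimes>\<^bsub>T \<Gamma>\<^esub> r g"
proof
  fix c
  have sub: "\<Gamma> \<subseteq> \<Sigma>" using \<Gamma> by (simp add: restricted_subfan_def subfan_def)
  let ?P = "\<lambda>\<Delta> f g. {(a, b). f a \<noteq> \<zero> \<and> g b \<noteq> \<zero> \<and> a + b = c \<and> (\<exists>C\<in>\<Delta>. a \<in> M C \<and> b \<in> M C)}"
  show "r (f \<otimes>\<^bsub>T \<Sigma>\<^esub> g) c = (r f \<otimes>\<^bsub>T \<Gamma>\<^esub> r g) c"
  proof (cases "c \<in> supp \<Gamma>")
    case True
    have iff: "(\<exists>C\<in>\<Sigma>. a \<in> M C \<and> b \<in> M C)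
        \<longleftrightarrow> (\<exists>C\<in>\<Gamma>. a \<in> M C \<and> b \<in> M C) \<and> a \<in> supp \<Gamma> \<and> b \<in> supp \<Gamma>"
      if "a + b = c" for a b
    proof
      assume "\<exists>C\<in>\<Sigma>. a \<in> M C \<and> b \<in> M C"
      then obtain C where C: "C \<in> \<Sigma>" "a \<in> M C" "b \<in> M C" by blast
      then have "a \<in> supp \<Gamma>" "b \<in> supp \<Gamma>"
        using subfan_support_addD[OF sub C] True that by simp_all
      then show "(\<exists>C\<in>\<Gamma>. a \<in> M C \<and> b \<in> M C) \<and> a \<in> supp \<Gamma> \<and> b \<in> supp \<Gamma>"
        using restricted_common_cone[OF \<Gamma> _ _ C] by simp
    qed (use sub in blast)
    have "f a \<noteq> \<zero> \<and> g b \<noteq> \<zero> \<and> a + b = c \<and> (\<exists>C\<in>\<Sigma>. a \<in> M C \<and> b \<in> M C) \<longleftrightarrow>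
        r f a \<noteq> \<zero> \<and> r g b \<noteq> \<zero> \<and> a + b = c \<and> (\<exists>C\<in>\<Gamma>. a \<in> M C \<and> b \<in> M C)" for a b
    proof (cases "a + b = c")
      case ab: True
      show ?thesis unfolding iff[OF ab] by (auto simp: r_def restrict_coeffs_def)
    qed simp
    then have eq: "?P \<Sigma> f g = ?P \<Gamma> (r f) (r g)" by simp
    have car: "r f a \<in> carrier K" "r g a \<in> carrier K" for a
      using f g by (auto simp: toric_carrier_iff r_def restrict_coeffs_def)
    have vals: "r f a = f a" "r g b = g b" if "(a, b) \<in> ?P \<Gamma> (r f) (r g)" for a b
      using that by (auto simp: r_def restrict_coeffs_def split: if_splits)
    have "finsum K (\<lambda>(a, b). f a \<otimes> g b) (?P \<Sigma> f g)
        = finsum K (\<lambda>(a, b). r f a \<otimes> r g b) (?P \<Gamma> (r f) (r g))"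
    proof (rule finsum_cong'[OF eq])
      show "(\<lambda>(a, b). r f a \<otimes> r g b) \<in> ?P \<Gamma> (r f) (r g) \<rightarrow> carrier K"
        using car by (intro Pi_I) (simp add: case_prod_unfold)
      show "(case p of (a, b) \<Rightarrow> f a \<otimes> g b) = (case p of (a, b) \<Rightarrow> r f a \<otimes> r g b)"
        if "p \<in> ?P \<Gamma> (r f) (r g)" for p
        using vals[of "fst p" "snd p"] that by (simp add: case_prod_unfold)
    qed
    moreover have "r (f \<otimes>\<^bsub>T \<Sigma>\<^esub> g) c = (f \<otimes>\<^bsub>T \<Sigma>\<^esub> g) c"
      using True by (simp add: r_def restrict_coeffs_def)
    ultimately show ?thesis unfolding toric_mult by (simp only:)
  next
    case False
    have "a + b \<in> supp \<Gamma>" if "C \<in> \<Gamma>" "a \<in> M C" "b \<in> M C" for C a b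
      using that monoid_add[of C a b] sub by (auto simp: complex_support_def)
    then have eq: "?P \<Gamma> (r f) (r g) = {}" using False by blast
    have "(r f \<otimes>\<^bsub>T \<Gamma>\<^esub> r g) c = \<zero>" unfolding toric_mult eq by simp
    then show ?thesis using False by (simp add: r_def restrict_coeffs_def)
  qed
qed

lemma zero_in_supp:
  assumes "restricted_subfan \<Gamma> \<Sigma>"
  shows "0 \<in> supp \<Gamma>"
proof -
  have "\<Gamma> \<subseteq> \<Sigma>" "\<Gamma> \<noteq> {}"
    using assms unfolding restricted_subfan_def subfan_def rational_pointed_fan_def by simp_all
  then show ?thesis using monoid_0 unfolding complex_support_def by blast
qed

lemma toric_restriction_hom:
  assumes \<Gamma>: "restricted_subfan \<Gamma> \<Sigma>"
  shows "restrict_coeffs (supp \<Gamma>) \<in> graded_algebra_hom K (T \<Sigma>) (Gr \<Sigma>) (T \<Gamma>) (Gr \<Gamma>)"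
proof -
  let ?r = "restrict_coeffs (supp \<Gamma>)"
  have "?r \<in> ring_hom (T \<Sigma>) (T \<Gamma>)"
  proof (rule ring_hom_memI)
    show "?r \<one>\<^bsub>T \<Sigma>\<^esub> = \<one>\<^bsub>T \<Gamma>\<^esub>"
      using zero_in_supp[OF \<Gamma>] by (auto simp: toric_one restrict_coeffs_def toric_monom_def)
    show "?r (f \<oplus>\<^bsub>T \<Sigma>\<^esub> g) = ?r f \<oplus>\<^bsub>T \<Gamma>\<^esub> ?r g" for f g
      by (auto simp: toric_add restrict_coeffs_def)
  qed (simp_all add: restrict_coeffs_carrier restrict_coeffs_mult[OF \<Gamma>])
  moreover have "?r (c \<odot>\<^bsub>T \<Sigma>\<^esub> f) = c \<odot>\<^bsub>T \<Gamma>\<^esub> ?r f" if "c \<in> carrier K" for c f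
    using that by (auto simp: toric_smult restrict_coeffs_def)
  moreover have "?r ` Gr \<Sigma> a \<subseteq> Gr \<Gamma> a" for a
    using restrict_coeffs_carrier by (auto simp: toric_grading_iff restrict_coeffs_def)
  ultimately show ?thesis by (simp add: graded_algebra_hom_def)
qed

section \<open>Homomorphisms between a graded algebra and a toric face ring\<close>

lemma toric_hom_zero_from:
  assumes "graded_algebra K A \<A>" and \<phi>: "\<phi> \<in> graded_algebra_hom K (T \<Gamma>) (Gr \<Gamma>) A \<A>"
  shows "\<phi> (\<lambda>a. \<zero>) = \<zero>\<^bsub>A\<^esub>"
proof -
  interpret A: algebra K A using assms(1) by (simp add: graded_algebra_def)
  have "\<phi> (\<lambda>a. \<zero>) \<in> carrier A"
    using \<phi> toric_zero_carrier by (auto simp: graded_algebra_hom_def ring_hom_def)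
  \<comment> \<open>\<open>ring_hom\<close> demands compatibility with sum, product and one only;
    preservation of zero comes from scaling by the zero of \<open>K\<close>.\<close>
  moreover have "\<phi> (\<zero> \<odot>\<^bsub>T \<Gamma>\<^esub> (\<lambda>a. \<zero>)) = \<zero> \<odot>\<^bsub>A\<^esub> \<phi> (\<lambda>a. \<zero>)"
    using \<phi> toric_zero_carrier[of \<Gamma>] by (simp add: graded_algebra_hom_def)
  ultimately show ?thesis by (simp add: toric_smult)
qed

lemma toric_hom_zero_to:
  assumes "graded_algebra K A \<A>" and h: "h \<in> graded_algebra_hom K A \<A> (T \<Gamma>) (Gr \<Gamma>)"
  shows "h \<zero>\<^bsub>A\<^esub> = (\<lambda>a. \<zero>)"
proof -
  interpret A: algebra K A using assms(1) by (simp add: graded_algebra_def)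
  have "h \<zero>\<^bsub>A\<^esub> \<in> carrier (T \<Gamma>)"
    using h A.zero_closed unfolding graded_algebra_hom_def by (blast intro: ring_hom_closed)
  moreover have "h (\<zero> \<odot>\<^bsub>A\<^esub> \<zero>\<^bsub>A\<^esub>) = \<zero> \<odot>\<^bsub>T \<Gamma>\<^esub> h \<zero>\<^bsub>A\<^esub>"
    using h zero_closed A.zero_closed unfolding graded_algebra_hom_def by blast
  ultimately show ?thesis by (simp add: toric_smult toric_carrier_iff)
qed

text \<open>Images of components of different degrees are supported at different exponents, so the
  coefficient at \<open>c\<close> sees only the summand of degree \<open>c\<close>.\<close>

lemma toric_hom_finsum:
  assumes A: "graded_algebra K A \<A>" and h: "h \<in> graded_algebra_hom K A \<A> (T \<Gamma>) (Gr \<Gamma>)"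
    and B: "finite B" and g: "\<And>b. g b \<in> \<A> b"
  shows "h (\<Oplus>\<^bsub>A\<^esub>b\<in>B. g b) c = (if c \<in> B then h (g c) c else \<zero>)"
proof -
  interpret A: algebra K A using A by (simp add: graded_algebra_def)
  have "submodule (\<A> b) K A" for b using A by (simp add: graded_algebra_def)
  then have gA: "g b \<in> carrier A" for b using A.submoduleE(1) g by blast
  have hc: "h x \<in> carrier (T \<Gamma>)" if "x \<in> carrier A" for x
    using h that by (auto simp: graded_algebra_hom_def ring_hom_def)
  have hg: "h (g b) \<in> Gr \<Gamma> b" for b using h g unfolding graded_algebra_hom_def by blast
  show ?thesis using B
  proof (induction B rule: finite_induct)
    case empty
    then show ?case using toric_hom_zero_to[OF A h] by simp
  next
    case (insert b B)
    let ?s = "\<Oplus>\<^bsub>A\<^esub>b\<in>B. g b"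
    have s: "?s \<in> carrier A" using gA by (intro A.finsum_closed) auto
    have "(\<Oplus>\<^bsub>A\<^esub>b\<in>insert b B. g b) = g b \<oplus>\<^bsub>A\<^esub> ?s"
      using insert.hyps gA by (intro A.finsum_insert) auto
    moreover have "h (g b \<oplus>\<^bsub>A\<^esub> ?s) = h (g b) \<oplus>\<^bsub>T \<Gamma>\<^esub> h ?s"
      using h gA s by (simp add: graded_algebra_hom_def ring_hom_add)
    ultimately have *: "h (\<Oplus>\<^bsub>A\<^esub>b\<in>insert b B. g b) c = h (g b) c \<oplus> h ?s c"
      by (simp add: toric_add)
    have car: "h (g b) c \<in> carrier K" using hc[OF gA] by (simp add: toric_carrier_iff)
    have "h ?s c \<in> carrier K" using hc[OF s] by (simp add: toric_carrier_iff)
    then show ?case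
      using * insert hg[of b] car by (auto simp: toric_grading_iff)
  qed
qed

text \<open>Only the grading needs an argument: a component of the preimage in a wrong degree has
  image zero, so it vanishes by injectivity of \<open>h\<close>.\<close>

lemma toric_iso_inverse:
  assumes A: "graded_algebra K A \<A>" and h: "h \<in> graded_algebra_hom K A \<A> (T \<Gamma>) (Gr \<Gamma>)"
    and bij: "bij_betw h (carrier A) (carrier (T \<Gamma>))"
  shows "inv_into (carrier A) h \<in> graded_algebra_hom K (T \<Gamma>) (Gr \<Gamma>) A \<A>"
proof -
  interpret A: algebra K A using A by (simp add: graded_algebra_def)
  let ?i = "inv_into (carrier A) h"
  have sm: "submodule (\<A> b) K A" for b using A by (simp add: graded_algebra_def)
  have hr: "h \<in> ring_hom A (T \<Gamma>)" using h by (simp add: graded_algebra_hom_def)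
  have ic: "?i f \<in> carrier A" and hi: "h (?i f) = f" if "f \<in> carrier (T \<Gamma>)" for f
    using bij that by (auto simp: bij_betw_def inv_into_into f_inv_into_f)
  have ih: "?i (h x) = x" if "x \<in> carrier A" for x
    using bij that by (simp add: bij_betw_def inv_into_f_f)
  have "?i \<in> ring_hom (T \<Gamma>) A"
  proof (rule ring_hom_memI)
    show "?i f \<in> carrier A" if "f \<in> carrier (T \<Gamma>)" for f using ic that .
    show "?i (f \<otimes>\<^bsub>T \<Gamma>\<^esub> g) = ?i f \<otimes>\<^bsub>A\<^esub> ?i g"
      if "f \<in> carrier (T \<Gamma>)" "g \<in> carrier (T \<Gamma>)" for f g
      using ih[of "?i f \<otimes>\<^bsub>A\<^esub> ?i g"] that by (simp add: ic hi ring_hom_mult[OF hr])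
    show "?i (f \<oplus>\<^bsub>T \<Gamma>\<^esub> g) = ?i f \<oplus>\<^bsub>A\<^esub> ?i g"
      if "f \<in> carrier (T \<Gamma>)" "g \<in> carrier (T \<Gamma>)" for f g
      using ih[of "?i f \<oplus>\<^bsub>A\<^esub> ?i g"] that by (simp add: ic hi ring_hom_add[OF hr])
    show "?i \<one>\<^bsub>T \<Gamma>\<^esub> = \<one>\<^bsub>A\<^esub>"
      using ih[of "\<one>\<^bsub>A\<^esub>"] by (simp add: ring_hom_one[OF hr])
  qed
  moreover have "?i (c \<odot>\<^bsub>T \<Gamma>\<^esub> f) = c \<odot>\<^bsub>A\<^esub> ?i f" if "c \<in> carrier K" "f \<in> carrier (T \<Gamma>)" for c f
  proof -
    have "h (c \<odot>\<^bsub>A\<^esub> ?i f) = c \<odot>\<^bsub>T \<Gamma>\<^esub> f"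
      using h that ic hi by (simp add: graded_algebra_hom_def)
    then show ?thesis using ih[of "c \<odot>\<^bsub>A\<^esub> ?i f"] that ic by simp
  qed
  moreover have "?i f \<in> \<A> a" if f: "f \<in> Gr \<Gamma> a" for f a
  proof -
    have fc: "f \<in> carrier (T \<Gamma>)" using f by (simp add: toric_grading_iff)
    have "\<exists>!g. (\<forall>a. g a \<in> \<A> a) \<and> finite {a. g a \<noteq> \<zero>\<^bsub>A\<^esub>} \<and>
        ?i f = (\<Oplus>\<^bsub>A\<^esub> a\<in>{a. g a \<noteq> \<zero>\<^bsub>A\<^esub>}. g a)"
      using A ic[OF fc] unfolding graded_algebra_def by blast
    then obtain g where g: "\<And>a. g a \<in> \<A> a" and fin: "finite {a. g a \<noteq> \<zero>\<^bsub>A\<^esub>}"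
      and sum: "?i f = (\<Oplus>\<^bsub>A\<^esub> a\<in>{a. g a \<noteq> \<zero>\<^bsub>A\<^esub>}. g a)" by blast
    have gA: "g b \<in> carrier A" for b using A.submoduleE(1)[OF sm] g by blast
    have "g b = \<zero>\<^bsub>A\<^esub>" if "b \<noteq> a" for b
    proof (rule ccontr)
      assume n: "g b \<noteq> \<zero>\<^bsub>A\<^esub>"
      have "f b = h (g b) b"
        using toric_hom_finsum[OF A h fin g, of b] sum hi[OF fc] n by simp
      then have "h (g b) b = \<zero>" using f that by (simp add: toric_grading_iff)
      moreover have "h (g b) \<in> Gr \<Gamma> b" using h g unfolding graded_algebra_hom_def by blast
      ultimately have "h (g b) = (\<lambda>a. \<zero>)" unfolding toric_grading_iff by (metis (no_types))
      then have "h (g b) = h \<zero>\<^bsub>A\<^esub>" using toric_hom_zero_to[OF A h] by simp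
      then show False using ih[OF gA[of b]] ih[OF A.zero_closed] n by simp
    qed
    \<comment> \<open>At most the degree \<open>a\<close> survives in the decomposition, and the sum
      is \<open>g a\<close> even when that component is zero.\<close>
    then have "b \<in> {b. g b \<noteq> \<zero>\<^bsub>A\<^esub>} \<longleftrightarrow> b \<in> (if g a = \<zero>\<^bsub>A\<^esub> then {} else {a})" for b
      by (cases "b = a") auto
    then have "{b. g b \<noteq> \<zero>\<^bsub>A\<^esub>} = (if g a = \<zero>\<^bsub>A\<^esub> then {} else {a})" by blast
    then have "?i f = g a" using sum gA by (simp split: if_splits)
    then show ?thesis using g by simp
  qed
  ultimately show ?thesis by (auto simp: graded_algebra_hom_def)
qed

section \<open>The two implications\<close>

lemma isomorphic_imp_retract:
  assumes A: "graded_algebra K A \<A>" and \<Gamma>: "restricted_subfan \<Gamma> \<Sigma>"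
    and iso: "graded_algebra_isomorphic K A \<A> (T \<Gamma>) (Gr \<Gamma>)"
  shows "graded_algebra_retract K A \<A> (T \<Sigma>) (Gr \<Sigma>)"
proof -
  obtain h where h: "h \<in> graded_algebra_hom K A \<A> (T \<Gamma>) (Gr \<Gamma>)"
    and bij: "bij_betw h (carrier A) (carrier (T \<Gamma>))"
    using iso by (auto simp: graded_algebra_isomorphic_def)
  \<comment> \<open>The identity function stands for the inclusion of \<open>T \<Gamma>\<close> into
    \<open>T \<Sigma>\<close>, which \<open>restrict_coeffs\<close> undoes.\<close>
  let ?\<theta> = "(\<lambda>f. f) \<circ> h"
  let ?\<phi> = "inv_into (carrier A) h \<circ> restrict_coeffs (supp \<Gamma>)"
  have "?\<theta> \<in> graded_algebra_hom K A \<A> (T \<Sigma>) (Gr \<Sigma>)"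
    using toric_inclusion_hom[OF \<Gamma>] h by (rule graded_algebra_hom_comp)
  moreover have "?\<phi> \<in> graded_algebra_hom K (T \<Sigma>) (Gr \<Sigma>) A \<A>"
    using toric_iso_inverse[OF A h bij] toric_restriction_hom[OF \<Gamma>] by (rule graded_algebra_hom_comp)
  moreover have "?\<phi> (?\<theta> x) = x" if "x \<in> carrier A" for x
  proof -
    have "h x \<in> carrier (T \<Gamma>)" using bij that by (auto simp: bij_betw_def)
    then show ?thesis using bij that by (simp add: restrict_coeffs_id bij_betw_def inv_into_f_f)
  qed
  ultimately show ?thesis unfolding graded_algebra_retract_def by blast
qed

lemma retract_imp_isomorphic:
  assumes A: "graded_algebra K A \<A>" and nz: "\<one>\<^bsub>A\<^esub> \<noteq> \<zero>\<^bsub>A\<^esub>"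
    and retract: "graded_algebra_retract K A \<A> (T \<Sigma>) (Gr \<Sigma>)"
  shows "\<exists>\<Gamma>. restricted_subfan \<Gamma> \<Sigma> \<and> graded_algebra_isomorphic K A \<A> (T \<Gamma>) (Gr \<Gamma>)"
proof -
  interpret A: algebra K A using A by (simp add: graded_algebra_def)
  obtain \<theta> \<phi> where \<theta>: "\<theta> \<in> graded_algebra_hom K A \<A> (T \<Sigma>) (Gr \<Sigma>)"
    and \<phi>: "\<phi> \<in> graded_algebra_hom K (T \<Sigma>) (Gr \<Sigma>) A \<A>"
    and id: "\<And>x. x \<in> carrier A \<Longrightarrow> \<phi> (\<theta> x) = x"
    using retract by (auto simp: graded_algebra_retract_def)
  let ?t = "toric_monom K"
  \<comment> \<open>The exponents whose monomials survive \<open>\<phi>\<close>; they turn out to be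
    those fixed by the idempotent.\<close>
  define S where "S = {a \<in> supp \<Sigma>. \<phi> (?t a) \<noteq> \<zero>\<^bsub>A\<^esub>}"
  have \<theta>r: "\<theta> \<in> ring_hom A (T \<Sigma>)" and \<phi>r: "\<phi> \<in> ring_hom (T \<Sigma>) A"
    using \<theta> \<phi> by (simp_all add: graded_algebra_hom_def)
  have \<theta>s: "\<theta> (c \<odot>\<^bsub>A\<^esub> x) = c \<odot>\<^bsub>T \<Sigma>\<^esub> \<theta> x" if "c \<in> carrier K" "x \<in> carrier A" for c x
    using \<theta> that by (simp add: graded_algebra_hom_def)
  have \<phi>s: "\<phi> (c \<odot>\<^bsub>T \<Sigma>\<^esub> f) = c \<odot>\<^bsub>A\<^esub> \<phi> f" if "c \<in> carrier K" "f \<in> carrier (T \<Sigma>)" for c f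
    using \<phi> that by (simp add: graded_algebra_hom_def)
  have \<theta>c: "\<theta> x \<in> carrier (T \<Sigma>)" if "x \<in> carrier A" for x
    using \<theta>r that by (rule ring_hom_closed)
  have \<phi>c: "\<phi> f \<in> carrier A" if "f \<in> carrier (T \<Sigma>)" for f
    using \<phi>r that by (rule ring_hom_closed)
  have single_smult: "(\<lambda>b. if b = a then c else \<zero>) = c \<odot>\<^bsub>T \<Sigma>\<^esub> ?t a" if "c \<in> carrier K" for a c
    using that by (auto simp: toric_smult toric_monom_def)
  have eS: "\<theta> (\<phi> (?t a)) = ?t a" if "a \<in> S" for a
  proof -
    have a: "a \<in> supp \<Sigma>" "\<phi> (?t a) \<noteq> \<zero>\<^bsub>A\<^esub>" using that by (auto simp: S_def)
    have tc: "?t a \<in> carrier (T \<Sigma>)" using a(1) by (rule toric_monom_carrier)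
    define c where "c = \<theta> (\<phi> (?t a)) a"
    have "\<phi> (?t a) \<in> \<A> a"
      using \<phi> toric_monom_grading[OF a(1)] unfolding graded_algebra_hom_def by blast
    then have g: "\<theta> (\<phi> (?t a)) \<in> Gr \<Sigma> a"
      using \<theta> unfolding graded_algebra_hom_def by blast
    then have c: "c \<in> carrier K" by (simp add: c_def toric_grading_iff toric_carrier_iff)
    have "\<theta> (\<phi> (?t a)) = (\<lambda>b. if b = a then c else \<zero>)"
      using g by (auto simp: toric_grading_iff c_def)
    then have e: "\<theta> (\<phi> (?t a)) = c \<odot>\<^bsub>T \<Sigma>\<^esub> ?t a" using single_smult[OF c] by simp
    \<comment> \<open>The grading forces a scalar multiple of the monomial. Applying
      \<open>\<phi>\<close> shows that \<open>c - 1\<close> annihilates the nonzero element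
      \<open>\<phi> (?t a)\<close>, and over a field this means \<open>c = 1\<close>.\<close>
    then have "\<phi> (?t a) = c \<odot>\<^bsub>A\<^esub> \<phi> (?t a)" using id[OF \<phi>c[OF tc]] \<phi>s[OF c tc] by simp
    then have "(c \<ominus> \<one>) \<odot>\<^bsub>A\<^esub> \<phi> (?t a) = \<zero>\<^bsub>A\<^esub>"
      using c \<phi>c[OF tc] by (simp add: a_minus_def A.smult_l_distr A.smult_l_minus A.r_neg)
    have "c = \<one>"
    proof (rule ccontr)
      assume "c \<noteq> \<one>"
      then have u: "c \<ominus> \<one> \<in> Units K" using c by (auto simp: field_Units r_right_minus_eq)
      then have "inv (c \<ominus> \<one>) \<odot>\<^bsub>A\<^esub> ((c \<ominus> \<one>) \<odot>\<^bsub>A\<^esub> \<phi> (?t a)) = \<phi> (?t a)"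
        using c \<phi>c[OF tc] by (simp flip: A.smult_assoc1)
      with \<open>(c \<ominus> \<one>) \<odot>\<^bsub>A\<^esub> \<phi> (?t a) = \<zero>\<^bsub>A\<^esub>\<close> a(2) u show False by simp
    qed
    moreover have "\<one> \<odot>\<^bsub>T \<Sigma>\<^esub> ?t a = ?t a" by (auto simp: toric_smult toric_monom_def)
    ultimately show ?thesis using e by simp
  qed
  have e0: "\<theta> (\<phi> (\<lambda>a. \<zero>)) = (\<lambda>a. \<zero>)"
    by (simp only: toric_hom_zero_from[OF A \<phi>] toric_hom_zero_to[OF A \<theta>])
  have e: "\<theta> (\<phi> f) = restrict_coeffs S f" if "f \<in> carrier (T \<Sigma>)" for f
    using that
  proof (induction f rule: toric_induct)
    case zero
    then show ?case using e0 by (auto simp: restrict_coeffs_def)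
  next
    case (single a c)
    have tc: "?t a \<in> carrier (T \<Sigma>)" using single(1) by (rule toric_monom_carrier)
    have *: "\<theta> (\<phi> (c \<odot>\<^bsub>T \<Sigma>\<^esub> ?t a)) = c \<odot>\<^bsub>T \<Sigma>\<^esub> \<theta> (\<phi> (?t a))"
      using single(2) tc \<phi>c by (simp add: \<phi>s \<theta>s)
    show ?case
    proof (cases "a \<in> S")
      case True
      then show ?thesis
        unfolding single_smult[OF single(2)] *
        using eS single(2) by (auto simp: restrict_coeffs_def toric_smult toric_monom_def)
    next
      case False
      then have "\<theta> (\<phi> (?t a)) = (\<lambda>a. \<zero>)"
        using single(1) toric_hom_zero_to[OF A \<theta>] by (simp add: S_def)
      then show ?thesis
        unfolding single_smult[OF single(2)] *
        using False single(2) by (auto simp: restrict_coeffs_def toric_smult toric_monom_def)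
    qed
  next
    case (add f g)
    have "\<phi> (f \<oplus>\<^bsub>T \<Sigma>\<^esub> g) = \<phi> f \<oplus>\<^bsub>A\<^esub> \<phi> g"
      using add(1,2) by (rule ring_hom_add[OF \<phi>r])
    then have "\<theta> (\<phi> (f \<oplus>\<^bsub>T \<Sigma>\<^esub> g)) = \<theta> (\<phi> f) \<oplus>\<^bsub>T \<Sigma>\<^esub> \<theta> (\<phi> g)"
      using ring_hom_add[OF \<theta>r \<phi>c[OF add(1)] \<phi>c[OF add(2)]] by simp
    then show ?case using add(3,4) by (auto simp: toric_add restrict_coeffs_def)
  qed
  have "0 \<in> supp \<Sigma>" using zero_cone monoid_0 unfolding complex_support_def by blast
  \<comment> \<open>The monomial of degree 0 is the one of the ring, and its image is the one of
    \<open>A\<close>, nonzero by \<open>nz\<close>.\<close>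
  then have "0 \<in> S"
    using nz ring_hom_one[OF \<phi>r] by (simp add: S_def toric_one)
  moreover have "S \<subseteq> supp \<Sigma>" by (auto simp: S_def)
  moreover have "a + b \<in> S \<longleftrightarrow> a \<in> S \<and> b \<in> S"
    if C: "C \<in> \<Sigma>" "a \<in> M C" "b \<in> M C" for C a b
  proof -
    have supp: "a \<in> supp \<Sigma>" "b \<in> supp \<Sigma>" "a + b \<in> supp \<Sigma>"
      using C monoid_add[OF C] unfolding complex_support_def by blast+
    have tc: "?t a \<in> carrier (T \<Sigma>)" "?t b \<in> carrier (T \<Sigma>)"
      using supp toric_monom_carrier by blast+
    have m: "\<phi> (?t (a + b)) = \<phi> (?t a) \<otimes>\<^bsub>A\<^esub> \<phi> (?t b)"
      using ring_hom_mult[OF \<phi>r tc] toric_monom_mult[OF C] by simp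
    show ?thesis
    proof
      assume "a + b \<in> S"
      then show "a \<in> S \<and> b \<in> S" using m supp tc \<phi>c by (auto simp: S_def)
    next
      assume ab: "a \<in> S \<and> b \<in> S"
      \<comment> \<open>\<open>A\<close> may have zero divisors, so the product is tested after
        \<open>\<theta>\<close>, where both factors are fixed monomials sharing the cone
        \<open>C\<close>.\<close>
      then have "\<theta> (\<phi> (?t (a + b))) = ?t (a + b)"
        unfolding m ring_hom_mult[OF \<theta>r \<phi>c[OF tc(1)] \<phi>c[OF tc(2)]]
        using eS toric_monom_mult[OF C] by simp
      moreover have "?t (a + b) (a + b) \<noteq> \<zero>" by (simp add: toric_monom_def)
      ultimately have "\<phi> (?t (a + b)) \<noteq> \<zero>\<^bsub>A\<^esub>" using toric_hom_zero_to[OF A \<theta>] by metis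
      then show "a + b \<in> S" using supp by (simp add: S_def)
    qed
  qed
  ultimately obtain \<Gamma> where \<Gamma>: "restricted_subfan \<Gamma> \<Sigma>" and supp: "supp \<Gamma> = S"
    by (rule restricted_subfan_of_face)
  have sub: "\<Gamma> \<subseteq> \<Sigma>" using \<Gamma> by (simp add: restricted_subfan_def subfan_def)
  have \<theta>\<Gamma>: "\<theta> x \<in> carrier (T \<Gamma>)" if x: "x \<in> carrier A" for x
  proof -
    \<comment> \<open>Since \<open>\<theta> x = \<theta> (\<phi> (\<theta> x))\<close>, the image of
      \<open>\<theta>\<close> is fixed by the projection onto \<open>S\<close>.\<close>
    have "\<theta> x = restrict_coeffs (supp \<Gamma>) (\<theta> x)"
      using e[OF \<theta>c[OF x]] id[OF x] supp by simp
    then show ?thesis using restrict_coeffs_carrier[OF \<theta>c[OF x], of \<Gamma>] by simp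
  qed
  have "\<theta> \<in> ring_hom A (T \<Gamma>)"
  proof (rule ring_hom_memI)
    show "\<theta> (x \<otimes>\<^bsub>A\<^esub> y) = \<theta> x \<otimes>\<^bsub>T \<Gamma>\<^esub> \<theta> y" if "x \<in> carrier A" "y \<in> carrier A" for x y
      using ring_hom_mult[OF \<theta>r that] toric_mult_restricted[OF \<Gamma> \<theta>\<Gamma> \<theta>\<Gamma>] that by simp
    show "\<theta> (x \<oplus>\<^bsub>A\<^esub> y) = \<theta> x \<oplus>\<^bsub>T \<Gamma>\<^esub> \<theta> y" if "x \<in> carrier A" "y \<in> carrier A" for x y
      using ring_hom_add[OF \<theta>r that] by (simp add: toric_add)
    show "\<theta> \<one>\<^bsub>A\<^esub> = \<one>\<^bsub>T \<Gamma>\<^esub>"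
      using ring_hom_one[OF \<theta>r] by (simp add: toric_one)
  qed (rule \<theta>\<Gamma>)
  moreover have "\<theta> x \<in> Gr \<Gamma> a" if x: "x \<in> \<A> a" for a x
  proof -
    have "submodule (\<A> a) K A" using A by (simp add: graded_algebra_def)
    then have "x \<in> carrier A" using x A.submoduleE(1) by blast
    moreover have "\<theta> x \<in> Gr \<Sigma> a" using x \<theta> unfolding graded_algebra_hom_def by blast
    ultimately show ?thesis using \<theta>\<Gamma> by (simp add: toric_grading_iff)
  qed
  ultimately have "\<theta> \<in> graded_algebra_hom K A \<A> (T \<Gamma>) (Gr \<Gamma>)"
    using \<theta>s by (auto simp: graded_algebra_hom_def toric_smult)
  moreover have "bij_betw \<theta> (carrier A) (carrier (T \<Gamma>))"
  proof (rule bij_betw_byWitness[where f' = \<phi>])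
    show "\<forall>f\<in>carrier (T \<Gamma>). \<theta> (\<phi> f) = f"
    proof
      fix f assume f: "f \<in> carrier (T \<Gamma>)"
      then have "\<theta> (\<phi> f) = restrict_coeffs (supp \<Gamma>) f"
        using e toric_carrier_mono[OF sub] supp by simp
      then show "\<theta> (\<phi> f) = f" using restrict_coeffs_id[OF f] by simp
    qed
    show "\<phi> ` carrier (T \<Gamma>) \<subseteq> carrier A" using \<phi>c toric_carrier_mono[OF sub] by blast
  qed (use id \<theta>\<Gamma> in auto)
  ultimately show ?thesis using \<Gamma> unfolding graded_algebra_isomorphic_def by blast
qed

end

theorem proposition4p5:
  fixes K :: "('k, 'r) ring_scheme"
    and \<Sigma> :: "(real ^ 'd::finite) set set"
    and M :: "(real ^ 'd) set \<Rightarrow> (int ^ 'd) set"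
    and A :: "('k, 'a, 'm) module_scheme"
    and \<A> :: "int ^ 'd \<Rightarrow> 'a set"
  assumes "field K"
    and "rational_pointed_fan \<Sigma>"
    and "monoidal_complex \<Sigma> M"
    and "graded_algebra K A \<A>"
    and "noetherian_ring A"
    and "\<one>\<^bsub>A\<^esub> \<noteq> \<zero>\<^bsub>A\<^esub>"
  shows "graded_algebra_retract K A \<A> (toric_face_ring K \<Sigma> M) (toric_grading K \<Sigma> M) \<longleftrightarrow>
    (\<exists>\<Gamma>. restricted_subfan \<Gamma> \<Sigma> \<and>
       graded_algebra_isomorphic K A \<A> (toric_face_ring K \<Gamma> M) (toric_grading K \<Gamma> M))"
proof -
  interpret field K by fact
  interpret toric_complex K \<Sigma> M
    using assms(2,3) by unfold_locales
  show ?thesis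
    using retract_imp_isomorphic[OF assms(4,6)] isomorphic_imp_retract[OF assms(4)] by blast
qed

end
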